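(* Let $n$ be a positive integer. Let $\mathrm{fs}^1(n)$ (resp. $\mathrm{fs}_{\rm b}(n)$) denote the number of isomorphism classes of all solutions $R$ on a finite set $X$ with $n$ elements such that $\pi_1\circ R:X\times X\to X$ is surjective (resp. $R$ is bijective). Then $$\mathrm{fs}^1(n)=\sum_{m\mid n}d(m),\qquad \mathrm{fs}_{\rm b}(n)=\sum_{m\mid n}p(m),$$ where $d(m)$ is the Davis number of $m$ and $p(m)$ is the number of all partitions of $m$.
   Context: For a set $X$ let $\tau_X(x,y)=(y,x)$ be the flip map on $X\times X$, and $\pi_1:X\times X\to X$ the first projection. For a map $R:X\times X\to X\times X$ put, as maps $X^3\to X^3$, $R^{12}=R\times \mathrm{Id}_X$, $R^{23}=\mathrm{Id}_X\times R$, $R^{13}=(\mathrm{Id}_X\times\tau_X)\circ R^{12}\circ(\mathrm{Id}_X\times\tau_X)$. $R$ is called a solution on $X$ (of the set-theoretic Frobenius-Separability equation) if $R^{12}R^{23}=R^{23}R^{13}=R^{13}R^{12}$. An isomorphism of solutions $(X,R)\to(X',R')$ is a bijection $\sigma:X\to X'$ with $(\sigma\times\sigma)\circ R=R'\circ(\sigma\times\sigma)$. The Davis number $d(m)$ is the number of orbits of $S_m$ acting by conjugation $f\mapsto\sigma\circ f\circ\sigma^{-1}$ on all self-maps $f$ of an $m$-element set. *)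

theory Defs
  imports "HOL-Algebra.Sym_Groups" "HOL-Algebra.Group_Action" "HOL-Library.Multiset"
begin

(* A triple (x, y, z) is ('a \<times> ('a \<times> 'a)), so R \<times> Id has to be written out for the
   left-associated product. *)
definition R12 :: "('a \<times> 'a \<Rightarrow> 'a \<times> 'a) \<Rightarrow> 'a \<times> 'a \<times> 'a \<Rightarrow> 'a \<times> 'a \<times> 'a" where
  "R12 R = (\<lambda>(x, y, z). let (u, v) = R (x, y) in (u, v, z))"

definition R23 :: "('a \<times> 'a \<Rightarrow> 'a \<times> 'a) \<Rightarrow> 'a \<times> 'a \<times> 'a \<Rightarrow> 'a \<times> 'a \<times> 'a" where
  "R23 R = map_prod id R"

definition R13 :: "('a \<times> 'a \<Rightarrow> 'a \<times> 'a) \<Rightarrow> 'a \<times> 'a \<times> 'a \<Rightarrow> 'a \<times> 'a \<times> 'a" where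
  "R13 R = map_prod id prod.swap \<circ> R12 R \<circ> map_prod id prod.swap"

(* Maps on the carrier X \<times> X are taken extensional, so that each map X \<times> X \<rightarrow> X \<times> X is
   represented by exactly one HOL function. *)
definition fs_solution :: "'a set \<Rightarrow> ('a \<times> 'a \<Rightarrow> 'a \<times> 'a) \<Rightarrow> bool" where
  "fs_solution X R \<longleftrightarrow>
     R \<in> X \<times> X \<rightarrow>\<^sub>E X \<times> X \<and>
     (\<forall>t \<in> X \<times> X \<times> X. (R12 R \<circ> R23 R) t = (R23 R \<circ> R13 R) t \<and>
                      (R23 R \<circ> R13 R) t = (R13 R \<circ> R12 R) t)"

definition fs_isomorphic ::
    "'a set \<Rightarrow> ('a \<times> 'a \<Rightarrow> 'a \<times> 'a) \<Rightarrow> 'b set \<Rightarrow> ('b \<times> 'b \<Rightarrow> 'b \<times> 'b) \<Rightarrow> bool" where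
  "fs_isomorphic X R X' R' \<longleftrightarrow>
     (\<exists>\<sigma>. bij_betw \<sigma> X X' \<and>
          (\<forall>p \<in> X \<times> X. (map_prod \<sigma> \<sigma> \<circ> R) p = (R' \<circ> map_prod \<sigma> \<sigma>) p))"

definition iso_classes ::
    "'a set \<Rightarrow> ('a \<times> 'a \<Rightarrow> 'a \<times> 'a) set \<Rightarrow> ('a \<times> 'a \<Rightarrow> 'a \<times> 'a) set set" where
  "iso_classes X S = S // {(R, R'). R \<in> S \<and> R' \<in> S \<and> fs_isomorphic X R X R'}"

(* The numbers fs^1(n) and fs_b(n), computed on a given carrier X with n elements. *)
definition fs1 :: "'a set \<Rightarrow> nat" where
  "fs1 X = card (iso_classes X {R. fs_solution X R \<and> (fst \<circ> R) ` (X \<times> X) = X})"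

definition fsb :: "'a set \<Rightarrow> nat" where
  "fsb X = card (iso_classes X {R. fs_solution X R \<and> bij_betw R (X \<times> X) (X \<times> X)})"

(* Elements of sym_group m are total functions fixing everything outside {1..m}; the inner
   restriction makes the conjugate extensional again, the outer one makes the action itself
   extensional, as BijGroup requires. *)
definition conj_action :: "nat \<Rightarrow> (nat \<Rightarrow> nat) \<Rightarrow> (nat \<Rightarrow> nat) \<Rightarrow> nat \<Rightarrow> nat" where
  "conj_action m \<sigma> =
     (\<lambda>f \<in> {1..m} \<rightarrow>\<^sub>E {1..m}. restrict (\<sigma> \<circ> f \<circ> inv_into UNIV \<sigma>) {1..m})"

definition davis :: "nat \<Rightarrow> nat" where
  "davis m = card (orbits (sym_group m) ({1..m} \<rightarrow>\<^sub>E {1..m}) (conj_action m))"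

definition partition_number :: "nat \<Rightarrow> nat" where
  "partition_number m = card {N :: nat multiset. 0 \<notin># N \<and> \<Sum>\<^sub># N = m}"

lemma fs_isomorphic_refl: "fs_isomorphic X R X R"
  unfolding fs_isomorphic_def by (intro exI[of _ id]) (auto simp: map_prod.id)

lemma fs_isomorphic_sym:
  assumes "R \<in> X \<times> X \<rightarrow>\<^sub>E X \<times> X" "fs_isomorphic X R X' R'"
  shows "fs_isomorphic X' R' X R"
proof -
  obtain \<sigma> where \<sigma>: "bij_betw \<sigma> X X'"
    and eq: "\<And>p. p \<in> X \<times> X \<Longrightarrow> map_prod \<sigma> \<sigma> (R p) = R' (map_prod \<sigma> \<sigma> p)"
    using assms(2) unfolding fs_isomorphic_def by auto
  define \<tau> where "\<tau> = inv_into X \<sigma>"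
  have \<tau>: "bij_betw \<tau> X' X" "\<And>x. x \<in> X \<Longrightarrow> \<tau> (\<sigma> x) = x" "\<And>y. y \<in> X' \<Longrightarrow> \<sigma> (\<tau> y) = y"
    using \<sigma> by (auto simp: \<tau>_def bij_betw_inv_into bij_betw_inv_into_left bij_betw_inv_into_right)
  have "map_prod \<tau> \<tau> (R' q) = R (map_prod \<tau> \<tau> q)" if q: "q \<in> X' \<times> X'" for q
  proof -
    define p where "p = map_prod \<tau> \<tau> q"
    have p: "p \<in> X \<times> X" and qp: "q = map_prod \<sigma> \<sigma> p"
      using q \<tau> by (auto simp: p_def bij_betw_def)
    have "R p \<in> X \<times> X"
      using p assms(1) by auto
    then have "map_prod \<tau> \<tau> (map_prod \<sigma> \<sigma> (R p)) = R p"
      using \<tau>(2) by (cases "R p") auto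
    then show ?thesis
      using eq[OF p] qp p_def by metis
  qed
  then show ?thesis
    using \<tau>(1) unfolding fs_isomorphic_def by auto
qed

lemma fs_isomorphic_trans:
  assumes "fs_isomorphic X R X' R'" "fs_isomorphic X' R' X'' R''"
  shows "fs_isomorphic X R X'' R''"
proof -
  obtain \<sigma> where \<sigma>: "bij_betw \<sigma> X X'"
    and eq: "\<And>p. p \<in> X \<times> X \<Longrightarrow> map_prod \<sigma> \<sigma> (R p) = R' (map_prod \<sigma> \<sigma> p)"
    using assms(1) unfolding fs_isomorphic_def by auto
  obtain \<tau> where \<tau>: "bij_betw \<tau> X' X''"
    and eq': "\<And>p. p \<in> X' \<times> X' \<Longrightarrow> map_prod \<tau> \<tau> (R' p) = R'' (map_prod \<tau> \<tau> p)"
    using assms(2) unfolding fs_isomorphic_def by auto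
  have "map_prod (\<tau> \<circ> \<sigma>) (\<tau> \<circ> \<sigma>) (R p) = R'' (map_prod (\<tau> \<circ> \<sigma>) (\<tau> \<circ> \<sigma>) p)" if p: "p \<in> X \<times> X" for p
  proof -
    have q: "map_prod \<sigma> \<sigma> p \<in> X' \<times> X'"
      using p \<sigma> by (auto simp: bij_betw_def)
    show ?thesis
      using eq[OF p] eq'[OF q] by (metis map_prod.compositionality)
  qed
  then show ?thesis
    using bij_betw_trans[OF \<sigma> \<tau>] unfolding fs_isomorphic_def by auto
qed

lemma equiv_fs_isomorphic:
  assumes "S \<subseteq> {R. fs_solution X R}"
  shows "equiv S {(R, R'). R \<in> S \<and> R' \<in> S \<and> fs_isomorphic X R X R'}"
    (is "equiv S ?r")
proof (rule equivI)
  show "?r \<subseteq> S \<times> S"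
    by (rule subsetI) (simp add: case_prod_unfold mem_Times_iff)
  show "refl_on S ?r"
    by (rule refl_onI) (simp add: fs_isomorphic_refl)
  show "sym ?r"
  proof (rule symI)
    fix R R' assume r: "(R, R') \<in> ?r"
    moreover have "R \<in> X \<times> X \<rightarrow>\<^sub>E X \<times> X"
      using assms r unfolding fs_solution_def by blast
    ultimately show "(R', R) \<in> ?r"
      using fs_isomorphic_sym by blast
  qed
  show "trans ?r"
  proof (rule transI)
    fix R R' R'' assume "(R, R') \<in> ?r" "(R', R'') \<in> ?r"
    then show "(R, R'') \<in> ?r"
      using fs_isomorphic_trans by blast
  qed
qed

lemma group_action_conj_action:
  "group_action (sym_group m) ({1..m} \<rightarrow>\<^sub>E {1..m}) (conj_action m)"
proof -
  let ?I = "{1..m}" and ?E = "{1..m} \<rightarrow>\<^sub>E {1..m}"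
  have closed: "conj_action m \<sigma> f \<in> ?E" if \<sigma>: "\<sigma> permutes ?I" and f: "f \<in> ?E" for \<sigma> f
  proof -
    have "\<sigma> (f (inv_into UNIV \<sigma> i)) \<in> ?I" if i: "i \<in> ?I" for i
    proof -
      have "inv_into UNIV \<sigma> i \<in> ?I"
        using i permutes_in_image[OF permutes_inv[OF \<sigma>]] by blast
      then have "f (inv_into UNIV \<sigma> i) \<in> ?I"
        using f by (rule PiE_mem[rotated])
      then show ?thesis
        using permutes_in_image[OF \<sigma>] by blast
    qed
    then show ?thesis
      using f by (auto simp del: atLeastAtMost_iff simp: conj_action_def)
  qed
  have mult: "conj_action m (\<sigma> \<circ> \<tau>) f = conj_action m \<sigma> (conj_action m \<tau> f)"
    if \<sigma>: "\<sigma> permutes ?I" and \<tau>: "\<tau> permutes ?I" and f: "f \<in> ?E" for \<sigma> \<tau> f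
  proof
    fix i
    have 1: "inv_into UNIV \<sigma> i \<in> ?I \<longleftrightarrow> i \<in> ?I"
      using permutes_in_image[OF permutes_inv[OF \<sigma>]] by blast
    have 2: "inv_into UNIV (\<sigma> \<circ> \<tau>) = inv_into UNIV \<tau> \<circ> inv_into UNIV \<sigma>"
      using \<sigma> \<tau> by (intro o_inv_distrib) (auto intro: permutes_bij)
    have 3: "conj_action m \<rho> g = restrict (\<rho> \<circ> g \<circ> inv_into UNIV \<rho>) ?I" if "g \<in> ?E" for \<rho> g
      using that by (simp add: conj_action_def)
    show "conj_action m (\<sigma> \<circ> \<tau>) f i = conj_action m \<sigma> (conj_action m \<tau> f) i"
      unfolding 3[OF closed[OF \<tau> f]] unfolding 3[OF f]
      using 1 2 by (simp del: atLeastAtMost_iff add: restrict_def)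
  qed
  have one: "conj_action m id f = f" if "f \<in> ?E" for f
    using that by (auto simp: conj_action_def fun_eq_iff restrict_def PiE_def extensional_def)
  have bij: "bij_betw (conj_action m \<sigma>) ?E ?E" if \<sigma>: "\<sigma> permutes ?I" for \<sigma>
  proof (rule bij_betw_byWitness[where f' = "conj_action m (inv_into UNIV \<sigma>)"])
    note \<sigma>' = permutes_inv[OF \<sigma>]
    show "\<forall>f\<in>?E. conj_action m (inv_into UNIV \<sigma>) (conj_action m \<sigma> f) = f"
      using mult[OF \<sigma>' \<sigma>] one permutes_inv_o(2)[OF \<sigma>] by metis
    show "\<forall>f\<in>?E. conj_action m \<sigma> (conj_action m (inv_into UNIV \<sigma>) f) = f"
      using mult[OF \<sigma> \<sigma>'] one permutes_inv_o(1)[OF \<sigma>] by metis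
    show "conj_action m \<sigma> ` ?E \<subseteq> ?E" "conj_action m (inv_into UNIV \<sigma>) ` ?E \<subseteq> ?E"
      using closed[OF \<sigma>] closed[OF \<sigma>'] by blast+
  qed
  have Bij: "conj_action m \<sigma> \<in> Bij ?E" if "\<sigma> permutes ?I" for \<sigma>
    using bij[OF that] by (simp add: Bij_def conj_action_def)
  have "conj_action m \<in> hom (sym_group m) (BijGroup ?E)"
  proof (rule homI)
    fix \<sigma> \<tau> assume "\<sigma> \<in> carrier (sym_group m)" "\<tau> \<in> carrier (sym_group m)"
    then have \<sigma>: "\<sigma> permutes ?I" and \<tau>: "\<tau> permutes ?I"
      by (auto simp: sym_group_carrier)
    have "conj_action m (\<sigma> \<circ> \<tau>) = compose ?E (conj_action m \<sigma>) (conj_action m \<tau>)"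
    proof
      fix f show "conj_action m (\<sigma> \<circ> \<tau>) f = compose ?E (conj_action m \<sigma>) (conj_action m \<tau>) f"
      proof (cases "f \<in> ?E")
        case True then show ?thesis using mult[OF \<sigma> \<tau>] by (simp add: compose_def)
      next
        case False then show ?thesis by (simp add: compose_def conj_action_def)
      qed
    qed
    then show "conj_action m (\<sigma> \<otimes>\<^bsub>sym_group m\<^esub> \<tau>) =
        conj_action m \<sigma> \<otimes>\<^bsub>BijGroup ?E\<^esub> conj_action m \<tau>"
      using Bij[OF \<sigma>] Bij[OF \<tau>] by (simp add: sym_group_mult BijGroup_def)
  next
    fix \<sigma> assume "\<sigma> \<in> carrier (sym_group m)"
    then show "conj_action m \<sigma> \<in> carrier (BijGroup ?E)"
      using Bij by (simp add: sym_group_carrier BijGroup_def del: One_nat_def)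
  qed
  then show ?thesis
    by (intro group_action.intro group_hom.intro group_hom_axioms.intro
        sym_group_is_group group_BijGroup)
qed

end

theory Submission
  imports Defs "HOL-Combinatorics.Orbits"
begin

text \<open>
  Write \<open>x y\<close> and \<open>x * y\<close> for the two components of \<open>R (x, y)\<close>. The equation for \<open>R\<close> forces
  \<open>x (y z) = x z = (x y) z\<close>, and if the product \<open>x y\<close> is onto then it is idempotent. Thus \<open>X\<close> is
  a rectangular band: \<open>X\<close> is a product \<open>A \<times> B\<close> with \<open>(a, b) (a', b') = (a, b')\<close>. The remaining
  identities leave exactly one freedom for the other component, a self-map \<open>\<theta>\<close> of \<open>B\<close> with
  \<open>(a, b) * (a', b') = (a', \<theta> b)\<close>, and every \<open>\<theta>\<close> occurs (\<open>solution_decomposition\<close>,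
  \<open>fs_solution_prod_solution\<close>).

  An isomorphism between two such solutions respects the coordinates of the rectangular bands, so
  it exists iff the factors have equal sizes and the two self-maps are conjugate
  (\<open>prod_solution_isomorphic\<close>, \<open>conjugate_of_prod_solution_isomorphic\<close>). An isomorphism class on
  \<open>n\<close> points is therefore a divisor \<open>m = card B\<close> of \<open>n\<close> together with a conjugacy class of
  self-maps of an \<open>m\<close>-element set, which gives the sum of the Davis numbers (\<open>card_iso_classes\<close>).

  The solution is bijective iff \<open>\<theta>\<close> is (\<open>bij_prod_solution_iff\<close>), so the bijective solutions are
  counted by conjugacy classes of permutations. These are classified by the multiset of cycle
  lengths, that is by partitions of \<open>m\<close> (\<open>conjugate_of_cycle_type_eq\<close>, \<open>cycle_type_surj\<close>,
  \<open>card_conjugacy_classes_permutations\<close>).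
\<close>

section \<open>Conjugate self-maps\<close>

definition conjugate :: "'a set \<Rightarrow> ('a \<Rightarrow> 'a) \<Rightarrow> 'b set \<Rightarrow> ('b \<Rightarrow> 'b) \<Rightarrow> bool" where
  "conjugate A f B g \<longleftrightarrow> (\<exists>\<sigma>. bij_betw \<sigma> A B \<and> (\<forall>x\<in>A. \<sigma> (f x) = g (\<sigma> x)))"

lemma conjugate_sym:
  assumes "conjugate A f B g" "f \<in> A \<rightarrow> A"
  shows "conjugate B g A f"
proof -
  obtain \<sigma> where \<sigma>: "bij_betw \<sigma> A B" and eq: "\<And>x. x \<in> A \<Longrightarrow> \<sigma> (f x) = g (\<sigma> x)"
    using assms(1) unfolding conjugate_def by auto
  have "inv_into A \<sigma> (g y) = f (inv_into A \<sigma> y)" if "y \<in> B" for y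
  proof -
    obtain x where x: "x \<in> A" "y = \<sigma> x"
      using \<sigma> \<open>y \<in> B\<close> by (auto simp: bij_betw_def)
    then show ?thesis
      using eq[OF x(1)] bij_betw_inv_into_left[OF \<sigma>] assms(2) by (metis funcset_mem)
  qed
  then show ?thesis
    using bij_betw_inv_into[OF \<sigma>] unfolding conjugate_def by blast
qed

lemma conjugate_trans:
  assumes "conjugate A f B g" "conjugate B g C h"
  shows "conjugate A f C h"
proof -
  obtain \<sigma> \<tau> where \<sigma>: "bij_betw \<sigma> A B" "\<And>x. x \<in> A \<Longrightarrow> \<sigma> (f x) = g (\<sigma> x)"
    and \<tau>: "bij_betw \<tau> B C" "\<And>x. x \<in> B \<Longrightarrow> \<tau> (g x) = h (\<tau> x)"
    using assms unfolding conjugate_def by auto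
  have "(\<tau> \<circ> \<sigma>) (f x) = h ((\<tau> \<circ> \<sigma>) x)" if "x \<in> A" for x
    using that \<sigma> \<tau>(2) by (auto simp: bij_betw_def)
  then show ?thesis
    using bij_betw_trans[OF \<sigma>(1) \<tau>(1)] unfolding conjugate_def by blast
qed

lemma conjugate_bij_betw:
  assumes "conjugate A f B g" "bij_betw f A A"
  shows "bij_betw g B B"
proof -
  obtain \<sigma> where \<sigma>: "bij_betw \<sigma> A B" and eq: "\<And>x. x \<in> A \<Longrightarrow> \<sigma> (f x) = g (\<sigma> x)"
    using assms(1) unfolding conjugate_def by auto
  have "bij_betw (\<sigma> \<circ> f \<circ> inv_into A \<sigma>) B B"
    using bij_betw_inv_into[OF \<sigma>] assms(2) \<sigma> by (blast intro: bij_betw_trans)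
  moreover have "(\<sigma> \<circ> f \<circ> inv_into A \<sigma>) y = g y" if "y \<in> B" for y
    using that \<sigma> eq[of "inv_into A \<sigma> y"]
    by (auto simp: bij_betw_inv_into_right bij_betw_def inv_into_into)
  ultimately show ?thesis
    by (simp cong: bij_betw_cong)
qed

lemma conjugate_to_carrier:
  assumes f: "f \<in> A \<rightarrow> A" and "finite A" "finite B" "card A = card B"
  obtains g where "g \<in> B \<rightarrow>\<^sub>E B" "conjugate A f B g"
proof -
  obtain \<sigma> where \<sigma>: "bij_betw \<sigma> A B"
    using assms by (metis finite_same_card_bij)
  let ?g = "restrict (\<sigma> \<circ> f \<circ> inv_into A \<sigma>) B"
  have "?g \<in> B \<rightarrow>\<^sub>E B"
    using f \<sigma> by (auto simp: bij_betw_def inv_into_into Pi_iff)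
  moreover have "\<sigma> (f x) = ?g (\<sigma> x)" if "x \<in> A" for x
    using that \<sigma> by (auto simp: bij_betw_def)
  ultimately show ?thesis
    using \<sigma> that unfolding conjugate_def by blast
qed

section \<open>Cycle types of permutations\<close>

text \<open>Each cycle is counted once because the orbits are collected in a set before their sizes
are collected in a multiset. If \<open>f\<close> maps \<open>B\<close> into itself, its values outside \<open>B\<close> do not
matter, so the definition applies to extensional maps.\<close>

definition cycle_type :: "('a \<Rightarrow> 'a) \<Rightarrow> 'a set \<Rightarrow> nat multiset" where
  "cycle_type f B = image_mset card (mset_set (Orbits.orbit f ` B))"

text \<open>An orbit consists of the iterates with a positive exponent, so this says that every point
of a finite set is periodic. The map need not permute the whole type; extending its
restriction by the identity gives a permutation with the same orbit.\<close>

lemma self_in_orbit_of_bij: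
  assumes "finite B" "bij_betw f B B" "x \<in> B"
  shows "x \<in> Orbits.orbit f x"
proof -
  let ?g = "perm_restrict f B"
  have "bij_betw ?g B B"
    using assms(2) by (simp add: perm_restrict_def cong: bij_betw_cong)
  then have "?g permutes B"
    by (intro bij_imp_permutes) (auto simp: perm_restrict_def)
  then have perm: "permutation ?g"
    using assms(1) by (auto simp: permutation_permutes)
  have "Orbits.orbit ?g x \<subseteq> B"
    using \<open>?g permutes B\<close> \<open>x \<in> B\<close> by (rule permutes_orbit_subset)
  then have "f s = ?g s" if "s \<in> Orbits.orbit ?g x" for s
    using that by (simp add: perm_restrict_def subset_iff)
  then have "Orbits.orbit f x = Orbits.orbit ?g x"
    by (rule orbit_cong[OF permutation_self_in_orbit[OF perm]])
  then show ?thesis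
    using permutation_self_in_orbit[OF perm] by metis
qed

lemma orbit_in_carrier:
  assumes "f \<in> B \<rightarrow> B" "x \<in> B"
  shows "Orbits.orbit f x \<subseteq> B"
proof
  fix y assume "y \<in> Orbits.orbit f x"
  then show "y \<in> B"
    by induction (use assms in auto)
qed

lemma orbit_eq_of_mem:
  assumes "finite B" "bij_betw f B B" "x \<in> B" "y \<in> Orbits.orbit f x"
  shows "Orbits.orbit f y = Orbits.orbit f x"
  using self_in_orbit_of_bij[OF assms(1-3)] assms(4) orbit_cyclic_eq3
  unfolding cyclic_on_def by metis

text \<open>A permutation restricts to the complement of any of its cycles. This is the induction step
of the classification of permutations up to conjugacy.\<close>

lemma cycle_type_remove_cycle:
  fixes C :: "'a set"
  assumes B: "finite B" and f: "bij_betw f B B" and x: "x \<in> B"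
  defines "C \<equiv> Orbits.orbit f x"
  shows "bij_betw f (B - C) (B - C)"
    and "cycle_type f B = add_mset (card C) (cycle_type f (B - C))"
proof -
  have xC: "x \<in> C"
    using self_in_orbit_of_bij[OF B f x] by (simp add: C_def)
  have CB: "C \<subseteq> B"
    unfolding C_def using f x by (intro orbit_in_carrier) (auto simp: bij_betw_def)
  have "f ` C = C"
  proof
    show "f ` C \<subseteq> C"
      unfolding C_def by (auto intro: orbit.step)
    show "C \<subseteq> f ` C"
    proof
      fix y assume "y \<in> C"
      then have "y \<in> Orbits.orbit f x"
        by (simp add: C_def)
      then show "y \<in> f ` C"
        by (cases rule: orbit.cases) (use xC in \<open>auto simp: C_def\<close>)
    qed
  qed
  then have "f ` (B - C) = B - C"
    using f CB by (simp add: bij_betw_def inj_on_image_set_diff[of f B])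
  then show "bij_betw f (B - C) (B - C)"
    using f by (auto simp: bij_betw_def intro: inj_on_subset)
  have "Orbits.orbit f y = C" if "y \<in> C" for y
    using orbit_eq_of_mem[OF B f x] that unfolding C_def .
  then have "Orbits.orbit f ` C = {C}"
    using xC by (simp add: image_constant)
  then have "Orbits.orbit f ` B = insert C (Orbits.orbit f ` (B - C))"
    using image_Un[of "Orbits.orbit f" C "B - C"] CB by (simp add: Un_absorb1)
  moreover have "C \<notin> Orbits.orbit f ` (B - C)"
    using self_in_orbit_of_bij[OF B f] by blast
  ultimately show "cycle_type f B = add_mset (card C) (cycle_type f (B - C))"
    using B by (simp add: cycle_type_def)
qed

lemma orbit_enumeration:
  assumes "finite B" "bij_betw f B B" "x \<in> B"
  shows "bij_betw (\<lambda>j. (f ^^ j) x) {0..<card (Orbits.orbit f x)} (Orbits.orbit f x)"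
    and "(f ^^ card (Orbits.orbit f x)) x = x"
proof -
  have x: "x \<in> Orbits.orbit f x"
    using self_in_orbit_of_bij[OF assms] .
  let ?k = "funpow_dist1 f x x"
  have inj: "inj_on (\<lambda>j. (f ^^ j) x) {0..<?k}"
    using x by (rule inj_on_funpow_dist1)
  have im: "Orbits.orbit f x = (\<lambda>j. (f ^^ j) x) ` {0..<?k}"
    using x by (rule orbit_conv_funpow_dist1)
  then have k: "card (Orbits.orbit f x) = ?k"
    using card_image[OF inj] by simp
  show "bij_betw (\<lambda>j. (f ^^ j) x) {0..<card (Orbits.orbit f x)} (Orbits.orbit f x)"
    unfolding k using inj im by (simp add: bij_betw_def)
  show "(f ^^ card (Orbits.orbit f x)) x = x"
    unfolding k using funpow_dist1_prop[OF x] .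
qed

text \<open>A cycle of length \<open>k\<close> is a copy of the successor map modulo \<open>k\<close>; matching the iterates of the
two base points aligns two such copies.\<close>

lemma conjugate_cycles:
  assumes A: "finite A" "bij_betw f A A" "x \<in> A" and B: "finite B" "bij_betw g B B" "y \<in> B"
    and card: "card (Orbits.orbit f x) = card (Orbits.orbit g y)"
  shows "conjugate (Orbits.orbit f x) f (Orbits.orbit g y) g"
proof -
  define k where "k = card (Orbits.orbit f x)"
  define e where "e = (\<lambda>j. (f ^^ j) x)"
  define e' where "e' = (\<lambda>j. (g ^^ j) y)"
  have e: "bij_betw e {0..<k} (Orbits.orbit f x)" "e k = x"
    using orbit_enumeration[OF A] by (auto simp: e_def k_def)
  have e': "bij_betw e' {0..<k} (Orbits.orbit g y)" "e' k = y"
    using orbit_enumeration[OF B] by (auto simp: e'_def k_def card)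
  define \<sigma> where "\<sigma> = e' \<circ> inv_into {0..<k} e"
  have \<sigma>e: "\<sigma> (e j) = e' j" if "j < k" for j
    using that bij_betw_inv_into_left[OF e(1)] by (simp add: \<sigma>_def)
  have "\<sigma> (f z) = g (\<sigma> z)" if z: "z \<in> Orbits.orbit f x" for z
  proof -
    obtain j where j: "j < k" "z = e j"
      using z bij_betw_imp_surj_on[OF e(1)] by (metis atLeastLessThan_iff imageE)
    \<comment> \<open>At \<open>Suc j = k\<close> both enumerations wrap around to their base points.\<close>
    have "f z = e (Suc j)" "g (\<sigma> z) = e' (Suc j)"
      using j \<sigma>e by (auto simp: e_def e'_def)
    moreover have "\<sigma> (e (Suc j)) = e' (Suc j)"
    proof (cases "Suc j = k")
      case True
      have "e 0 = x" "e' 0 = y"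
        by (auto simp: e_def e'_def)
      then show ?thesis
        using True e(2) e'(2) \<sigma>e[of 0] j by force
    qed (use \<sigma>e j in auto)
    ultimately show ?thesis
      by simp
  qed
  moreover have "bij_betw \<sigma> (Orbits.orbit f x) (Orbits.orbit g y)"
    unfolding \<sigma>_def using bij_betw_inv_into[OF e(1)] e'(1) by (rule bij_betw_trans)
  ultimately show ?thesis
    unfolding conjugate_def by blast
qed

lemma conjugate_disjoint_union:
  assumes "conjugate A f B g" "conjugate A' f B' g"
    and "f \<in> A \<rightarrow> A" "f \<in> A' \<rightarrow> A'" "A \<inter> A' = {}" "B \<inter> B' = {}"
  shows "conjugate (A \<union> A') f (B \<union> B') g"
proof -
  obtain \<sigma> \<tau> where \<sigma>: "bij_betw \<sigma> A B" "\<And>x. x \<in> A \<Longrightarrow> \<sigma> (f x) = g (\<sigma> x)"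
    and \<tau>: "bij_betw \<tau> A' B'" "\<And>x. x \<in> A' \<Longrightarrow> \<tau> (f x) = g (\<tau> x)"
    using assms(1,2) unfolding conjugate_def by auto
  let ?\<rho> = "\<lambda>x. if x \<in> A then \<sigma> x else \<tau> x"
  have "bij_betw ?\<rho> (A \<union> A') (B \<union> B')"
    using \<sigma>(1) \<tau>(1) assms(5,6) by (rule bij_betw_disjoint_Un)
  moreover have "?\<rho> (f x) = g (?\<rho> x)" if "x \<in> A \<union> A'" for x
    using that assms(3-5) \<sigma>(2) \<tau>(2) by (auto simp: Pi_iff)
  ultimately show ?thesis
    unfolding conjugate_def by blast
qed

lemma orbit_conjugate:
  assumes eq: "\<And>x. x \<in> A \<Longrightarrow> \<sigma> (f x) = g (\<sigma> x)" and f: "f \<in> A \<rightarrow> A" and x: "x \<in> A"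
  shows "Orbits.orbit g (\<sigma> x) = \<sigma> ` Orbits.orbit f x"
proof -
  have "(f ^^ j) x \<in> A \<and> (g ^^ j) (\<sigma> x) = \<sigma> ((f ^^ j) x)" for j
    by (induction j) (use eq f x in auto)
  then show ?thesis
    by (auto simp: orbit_altdef)
qed

lemma cycle_type_conjugate:
  assumes "conjugate A f B g" "f \<in> A \<rightarrow> A"
  shows "cycle_type f A = cycle_type g B"
proof -
  obtain \<sigma> where \<sigma>: "bij_betw \<sigma> A B" and eq: "\<And>x. x \<in> A \<Longrightarrow> \<sigma> (f x) = g (\<sigma> x)"
    using assms(1) unfolding conjugate_def by auto
  note inj = bij_betw_imp_inj_on[OF \<sigma>]
  have sub: "C \<subseteq> A" if "C \<in> Orbits.orbit f ` A" for C
    using that orbit_in_carrier[OF assms(2)] by blast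
  have inj_img: "inj_on ((`) \<sigma>) (Orbits.orbit f ` A)"
    using sub inj by (meson inj_onI inj_on_image_eq_iff)
  have "Orbits.orbit g ` B = (`) \<sigma> ` Orbits.orbit f ` A"
    using \<sigma> orbit_conjugate[of A \<sigma> f g, OF eq assms(2)]
    by (force simp: bij_betw_def)
  then have "cycle_type g B = image_mset card (image_mset ((`) \<sigma>) (mset_set (Orbits.orbit f ` A)))"
    using image_mset_mset_set[OF inj_img] by (simp add: cycle_type_def)
  also have "\<dots> = image_mset (\<lambda>C. card (\<sigma> ` C)) (mset_set (Orbits.orbit f ` A))"
    by (simp add: multiset.map_comp comp_def)
  also have "\<dots> = cycle_type f A"
    unfolding cycle_type_def
  proof (rule image_mset_cong)
    fix C assume "C \<in># mset_set (Orbits.orbit f ` A)"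
    then have "C \<subseteq> A"
      using sub by (metis elem_mset_set empty_iff mset_set.infinite set_mset_empty)
    then show "card (\<sigma> ` C) = card C"
      using inj by (meson card_image inj_on_subset)
  qed
  finally show ?thesis ..
qed

text \<open>Remove a cycle from the first map and one of the same length from the second, conjugate the
rest by induction, and glue.\<close>

lemma conjugate_of_cycle_type_eq:
  assumes "finite A" "finite B" "bij_betw f A A" "bij_betw g B B" "cycle_type f A = cycle_type g B"
  shows "conjugate A f B g"
  using assms
proof (induction "card A" arbitrary: A B rule: less_induct)
  case less
  note A = less.prems(1,3) and B = less.prems(2,4)
  show ?case
  proof (cases "A = {}")
    case True
    then have "cycle_type g B = {#}"
      using less.prems(5) by (simp add: cycle_type_def)
    then have "B = {}"
      using less.prems(2) by (auto simp: cycle_type_def mset_set_empty_iff)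
    with True show ?thesis
      by (auto simp: conjugate_def bij_betw_def)
  next
    case False
    then obtain x where x: "x \<in> A"
      by blast
    let ?C = "Orbits.orbit f x"
    note remA = cycle_type_remove_cycle[OF A x]
    have "card ?C \<in># cycle_type g B"
      using remA(2) less.prems(5) by (metis union_single_eq_member)
    then obtain y where y: "y \<in> B" "card ?C = card (Orbits.orbit g y)"
      using less.prems(2) by (auto simp: cycle_type_def)
    let ?D = "Orbits.orbit g y"
    note remB = cycle_type_remove_cycle[OF B y(1)]
    have sub: "?C \<subseteq> A" "?D \<subseteq> B"
      using A(2) B(2) x y(1) by (simp_all add: orbit_in_carrier bij_betw_imp_funcset)
    have "x \<in> ?C"
      using self_in_orbit_of_bij[OF A x] .
    then have "card (A - ?C) < card A"
      using x A(1) by (intro psubset_card_mono) auto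
    moreover have "cycle_type f (A - ?C) = cycle_type g (B - ?D)"
      using remA(2) remB(2) y(2) less.prems(5) by simp
    ultimately have "conjugate (A - ?C) f (B - ?D) g"
      using less.hyps less.prems(1,2) remA(1) remB(1) by simp
    moreover have "conjugate ?C f ?D g"
      using A x B y by (rule conjugate_cycles)
    ultimately have "conjugate (?C \<union> (A - ?C)) f (?D \<union> (B - ?D)) g"
      using remA(1)
      by (intro conjugate_disjoint_union) (auto simp: bij_betw_def intro: orbit.step)
    then show ?thesis
      using sub by (simp add: Un_absorb1)
  qed
qed

lemma cycle_type_is_partition:
  assumes "finite B" "bij_betw f B B"
  shows "0 \<notin># cycle_type f B" "\<Sum>\<^sub># (cycle_type f B) = card B"
proof -
  have fin: "finite C \<and> C \<noteq> {}" if "C \<in> Orbits.orbit f ` B" for C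
    using that assms orbit_in_carrier[of f B]
    by (auto simp: bij_betw_def orbit_nonempty intro: finite_subset)
  then show "0 \<notin># cycle_type f B"
    using assms(1) by (auto simp: cycle_type_def)
  have "\<Union>(Orbits.orbit f ` B) = B"
    using self_in_orbit_of_bij[OF assms] orbit_in_carrier[of f B] assms(2)
    by (fastforce simp: bij_betw_def)
  moreover have "pairwise disjnt (Orbits.orbit f ` B)"
    unfolding pairwise_def disjnt_def using orbit_eq_of_mem[OF assms] by blast
  ultimately have "card B = sum card (Orbits.orbit f ` B)"
    using fin card_Union_disjoint by metis
  then show "\<Sum>\<^sub># (cycle_type f B) = card B"
    by (simp add: cycle_type_def sum_unfold_sum_mset)
qed

text \<open>A permutation with a prescribed cycle type is built one cycle at a time: a new cycle of
length \<open>k\<close> is put on an interval of \<open>k\<close> numbers beyond all points used so far.\<close>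

lemma cycle_type_surj:
  assumes "0 \<notin># N"
  shows "\<exists>(B :: nat set) f. finite B \<and> bij_betw f B B \<and> cycle_type f B = N"
  using assms
proof (induction N)
  case empty
  show ?case
    by (rule exI[of _ "{}"]) (auto simp: cycle_type_def)
next
  case (add k N)
  then obtain B :: "nat set" and f where B: "finite B" "bij_betw f B B" "cycle_type f B = N"
    by auto
  define M where "M = Suc (Max (insert 0 B))"
  have M: "b < M" if "b \<in> B" for b
    using that B(1) by (simp add: M_def less_Suc_eq_le)
  have k: "k > 0"
    using add.prems by auto
  define g where "g = (\<lambda>i. if i \<in> B then f i else if Suc i = M + k then M else Suc i)"
  let ?C = "{M..<M + k}"
  have disj: "B \<inter> ?C = {}"
    using M by force
  have gC: "g i = (if Suc i = M + k then M else Suc i)" if "i \<in> ?C" for i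
    using that disj by (auto simp: g_def)
  have "?C \<subseteq> g ` ?C"
  proof
    fix i assume i: "i \<in> ?C"
    let ?j = "if i = M then M + k - 1 else i - 1"
    have "?j \<in> ?C"
      using i k by auto
    moreover have "g ?j = i"
      using gC[OF \<open>?j \<in> ?C\<close>] i k by auto
    ultimately show "i \<in> g ` ?C"
      by (metis imageI)
  qed
  moreover have "g ` ?C \<subseteq> ?C"
    using gC by auto
  ultimately have "g ` ?C = ?C"
    by blast
  then have "bij_betw g ?C ?C"
    by (simp add: bij_betw_def eq_card_imp_inj_on)
  moreover have "bij_betw g B B"
    using B(2) by (simp add: g_def cong: bij_betw_cong)
  ultimately have g: "bij_betw g (B \<union> ?C) (B \<union> ?C)"
    using disj by (intro bij_betw_combine) auto
  have pow: "(g ^^ j) M = M + j" if "j < k" for j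
    using that disj by (induction j) (auto simp: g_def)
  have "M + j \<in> Orbits.orbit g M" if "j < k" for j
  proof (cases j)
    case 0
    have "M \<in> B \<union> ?C"
      using k by simp
    then show ?thesis
      using self_in_orbit_of_bij[OF _ g] B(1) 0 by simp
  next
    case (Suc i)
    then have "(g ^^ j) M \<in> Orbits.orbit g M"
      unfolding orbit_altdef by blast
    then show ?thesis
      by (simp only: pow[OF that])
  qed
  then have "?C \<subseteq> Orbits.orbit g M"
    by (auto simp: le_iff_add)
  moreover have "Orbits.orbit g M \<subseteq> ?C"
    using \<open>g ` ?C = ?C\<close> k by (intro orbit_in_carrier) auto
  ultimately have orb: "Orbits.orbit g M = ?C"
    by blast
  have "conjugate B f B g"
    unfolding conjugate_def by (rule exI[of _ id]) (auto simp: g_def)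
  then have "cycle_type g B = N"
    using B(3) cycle_type_conjugate bij_betw_imp_funcset[OF B(2)] by metis
  moreover have "cycle_type g (B \<union> ?C) = add_mset k (cycle_type g B)"
    using cycle_type_remove_cycle(2)[OF _ g, of M] B(1) k orb disj
    by (simp add: Un_Diff Diff_triv)
  ultimately show ?case
    using g B(1) by (intro exI[of _ "B \<union> ?C"] exI[of _ g]) simp
qed

section \<open>Counting equivalence classes by invariants\<close>

text \<open>The relation \<open>Q\<close> says which objects have which invariant. It is a relation rather than a
function because an isomorphism with a standard model, which is how solutions receive their
invariant below, involves a choice.\<close>

lemma card_quotient_by_invariant:
  assumes r: "equiv S r"
    and total: "\<And>x. x \<in> S \<Longrightarrow> \<exists>i\<in>I. Q x i"
    and onto: "\<And>i. i \<in> I \<Longrightarrow> \<exists>x\<in>S. Q x i"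
    and complete: "\<And>x y i j. x \<in> S \<Longrightarrow> y \<in> S \<Longrightarrow> i \<in> I \<Longrightarrow> j \<in> I \<Longrightarrow> Q x i \<Longrightarrow> Q y j \<Longrightarrow>
      (x, y) \<in> r \<longleftrightarrow> i = j"
  shows "card (S // r) = card I"
proof -
  obtain h where h: "\<And>x. x \<in> S \<Longrightarrow> h x \<in> I \<and> Q x (h x)"
    using total by metis
  have r_iff: "(x, y) \<in> r \<longleftrightarrow> h x = h y" if "x \<in> S" "y \<in> S" for x y
    using complete[OF that] h that by metis
  have img: "h ` S = I"
  proof
    show "I \<subseteq> h ` S"
    proof
      fix i assume i: "i \<in> I"
      then obtain x where x: "x \<in> S" "Q x i"
        using onto by blast
      then have "i = h x"
        using complete[OF x(1) x(1) i _ x(2)] h equiv_class_self[OF r x(1)] by auto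
      then show "i \<in> h ` S"
        using x(1) by blast
    qed
  qed (use h in auto)
  have cls: "r `` {x} = {y \<in> S. h y = h x}" if "x \<in> S" for x
    using r_iff[OF that] equiv_type[OF r] by auto
  have "S // r = (\<lambda>i. {y \<in> S. h y = i}) ` I"
    unfolding img[symmetric] quotient_def by (auto simp: cls)
  moreover have "inj_on (\<lambda>i. {y \<in> S. h y = i}) I"
    unfolding img[symmetric] by (rule inj_onI) blast
  ultimately show ?thesis
    by (simp add: card_image)
qed

section \<open>Conjugacy classes on a standard set\<close>

definition conj_rel :: "nat \<Rightarrow> (nat \<Rightarrow> nat) set \<Rightarrow> ((nat \<Rightarrow> nat) \<times> (nat \<Rightarrow> nat)) set" where
  "conj_rel m F = {(f, g). f \<in> F \<and> g \<in> F \<and> conjugate {1..m} f {1..m} g}"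

lemma equiv_conj_rel:
  assumes "F \<subseteq> {1..m} \<rightarrow>\<^sub>E {1..m}"
  shows "equiv F (conj_rel m F)"
proof (rule equivI)
  show "conj_rel m F \<subseteq> F \<times> F"
    by (auto simp: conj_rel_def)
  show "refl_on F (conj_rel m F)"
    by (rule refl_onI) (auto simp: conj_rel_def conjugate_def intro: exI[of _ id])
  show "sym (conj_rel m F)"
    using assms by (intro symI) (auto simp: conj_rel_def intro!: conjugate_sym)
  show "trans (conj_rel m F)"
    by (rule transI) (auto simp: conj_rel_def intro: conjugate_trans)
qed

text \<open>Extending a bijection of \<open>{1..m}\<close> by the identity makes it an element of the symmetric
group, so conjugacy of extensional maps is the orbit relation of the conjugation action.\<close>

lemma conjugate_iff_conj_action:
  assumes f: "f \<in> {1..m} \<rightarrow>\<^sub>E {1..m}" and g: "g \<in> {1..m} \<rightarrow>\<^sub>E {1..m}"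
  shows "conjugate {1..m} f {1..m} g \<longleftrightarrow> (\<exists>\<sigma>. \<sigma> permutes {1..m} \<and> g = conj_action m \<sigma> f)"
    (is "?L \<longleftrightarrow> ?R")
proof
  assume ?L
  then obtain \<sigma> where \<sigma>: "bij_betw \<sigma> {1..m} {1..m}" and eq: "\<And>x. x \<in> {1..m} \<Longrightarrow> \<sigma> (f x) = g (\<sigma> x)"
    unfolding conjugate_def by auto
  let ?\<rho> = "restrict_id \<sigma> {1..m}"
  have \<rho>: "?\<rho> permutes {1..m}"
    using \<sigma> by (rule permutes_restrict_id)
  have "g y = conj_action m ?\<rho> f y" for y
  proof (cases "y \<in> {1..m}")
    case True
    let ?x = "inv_into UNIV ?\<rho> y"
    have x: "?x \<in> {1..m}"
      using True permutes_in_image[OF permutes_inv[OF \<rho>]] by blast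
    have fx: "f ?x \<in> {1..m}"
      using f x by (rule PiE_mem)
    have "y = ?\<rho> ?x"
      using permutes_inverses(1)[OF \<rho>] by simp
    then have "g y = ?\<rho> (f ?x)"
      using eq[OF x] x fx by (metis restrict_id_simps(1))
    then show ?thesis
      using True f by (simp add: conj_action_def del: atLeastAtMost_iff)
  next
    case False
    then show ?thesis
      using f PiE_arb[OF g] by (simp add: conj_action_def del: atLeastAtMost_iff)
  qed
  with \<rho> show ?R
    by blast
next
  assume ?R
  then obtain \<sigma> where \<sigma>: "\<sigma> permutes {1..m}" and eq: "g = conj_action m \<sigma> f"
    by blast
  have "\<sigma> (f x) = g (\<sigma> x)" if "x \<in> {1..m}" for x
    using that f permutes_in_image[OF \<sigma>, of x] permutes_inverses(2)[OF \<sigma>]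
    by (simp add: eq conj_action_def del: atLeastAtMost_iff)
  then show ?L
    using permutes_imp_bij[OF \<sigma>] unfolding conjugate_def by blast
qed

lemma card_conjugacy_classes_self_maps:
  "card (({1..m} \<rightarrow>\<^sub>E {1..m}) // conj_rel m ({1..m} \<rightarrow>\<^sub>E {1..m})) = davis m"
proof -
  let ?E = "{1..m} \<rightarrow>\<^sub>E {1..m}"
  interpret group_action "sym_group m" ?E "conj_action m"
    by (rule group_action_conj_action)
  have "Group_Action.orbit (sym_group m) (conj_action m) f = conj_rel m ?E `` {f}" if f: "f \<in> ?E" for f
  proof -
    have "conj_action m \<sigma> f \<in> ?E" if "\<sigma> permutes {1..m}" for \<sigma>
      using element_image[OF _ f refl] that by (simp add: sym_group_carrier)
    then show ?thesis
      using conjugate_iff_conj_action[OF f] f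
      by (auto simp: Group_Action.orbit_def conj_rel_def sym_group_def)
  qed
  then have "orbits (sym_group m) ?E (conj_action m) = ?E // conj_rel m ?E"
    unfolding orbits_def quotient_def by blast
  then show ?thesis
    by (simp add: davis_def)
qed

lemma card_conjugacy_classes_permutations:
  fixes m :: nat
  defines "F \<equiv> {f \<in> {1..m} \<rightarrow>\<^sub>E {1..m}. bij_betw f {1..m} {1..m}}"
  shows "card (F // conj_rel m F) = partition_number m"
  unfolding partition_number_def
proof (rule card_quotient_by_invariant[where Q = "\<lambda>f N. N = cycle_type f {1..m}"])
  show "equiv F (conj_rel m F)"
    by (rule equiv_conj_rel) (auto simp: F_def)
  show "\<exists>N\<in>{N. 0 \<notin># N \<and> \<Sum>\<^sub># N = m}. N = cycle_type f {1..m}" if "f \<in> F" for f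
    using that cycle_type_is_partition[of "{1..m}" f] by (simp add: F_def)
  show "\<exists>f\<in>F. N = cycle_type f {1..m}" if N: "N \<in> {N. 0 \<notin># N \<and> \<Sum>\<^sub># N = m}" for N
  proof -
    obtain B :: "nat set" and f where f: "finite B" "bij_betw f B B" "cycle_type f B = N"
      using cycle_type_surj N by blast
    then have "card B = card {1..m}"
      using cycle_type_is_partition(2)[OF f(1,2)] N by simp
    then obtain g where g: "g \<in> {1..m} \<rightarrow>\<^sub>E {1..m}" "conjugate B f {1..m} g"
      using f(1,2) conjugate_to_carrier[of f B "{1..m}"] by (auto simp: bij_betw_imp_funcset)
    have "g \<in> F"
      using g(1) conjugate_bij_betw[OF g(2) f(2)] by (simp add: F_def)
    moreover have "N = cycle_type g {1..m}"
      using cycle_type_conjugate[OF g(2) bij_betw_imp_funcset[OF f(2)]] f(3) by simp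
    ultimately show ?thesis
      by blast
  qed
  show "(f, g) \<in> conj_rel m F \<longleftrightarrow> N = N'"
    if "f \<in> F" "g \<in> F" "N = cycle_type f {1..m}" "N' = cycle_type g {1..m}" for f g N N'
    using that cycle_type_conjugate[of "{1..m}" f "{1..m}" g]
      conjugate_of_cycle_type_eq[of "{1..m}" "{1..m}" f g]
    by (auto simp: F_def conj_rel_def)
qed

section \<open>Solutions with surjective first component\<close>

text \<open>Writing \<open>x y\<close> and \<open>x * y\<close> for the two components of \<open>R (x, y)\<close>, these are the identities
\<open>x (y z) = x z = (x y) z\<close>, \<open>x * (y z) = x * y = y (x * z)\<close> and
\<open>y * (x * z) = y * z = (x y) * z\<close>. The first pair is the law of rectangular bands.\<close>

lemma fs_solution_iff:
  "fs_solution X R \<longleftrightarrow> R \<in> X \<times> X \<rightarrow>\<^sub>E X \<times> X \<and>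
    (\<forall>x\<in>X. \<forall>y\<in>X. \<forall>z\<in>X.
      fst (R (x, fst (R (y, z)))) = fst (R (x, z)) \<and>
      fst (R (fst (R (x, y)), z)) = fst (R (x, z)) \<and>
      snd (R (x, fst (R (y, z)))) = snd (R (x, y)) \<and>
      fst (R (y, snd (R (x, z)))) = snd (R (x, y)) \<and>
      snd (R (y, snd (R (x, z)))) = snd (R (y, z)) \<and>
      snd (R (fst (R (x, y)), z)) = snd (R (y, z)))"
proof -
  have triples: "(R12 R \<circ> R23 R) (x, y, z) =
        (fst (R (x, fst (R (y, z)))), snd (R (x, fst (R (y, z)))), snd (R (y, z)))"
      "(R23 R \<circ> R13 R) (x, y, z) =
        (fst (R (x, z)), fst (R (y, snd (R (x, z)))), snd (R (y, snd (R (x, z)))))"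
      "(R13 R \<circ> R12 R) (x, y, z) =
        (fst (R (fst (R (x, y)), z)), snd (R (x, y)), snd (R (fst (R (x, y)), z)))" for x y z
    by (simp_all add: R12_def R23_def R13_def case_prod_unfold Let_def prod_eq_iff)
  have ball: "(\<forall>t\<in>X \<times> X \<times> X. P t) \<longleftrightarrow> (\<forall>x\<in>X. \<forall>y\<in>X. \<forall>z\<in>X. P (x, y, z))" for P
    by auto
  show ?thesis
    unfolding fs_solution_def ball triples prod.inject
    by (rule conj_cong[OF refl], (rule ball_cong[OF refl])+, metis)
qed

text \<open>The first component of this solution is the rectangular band on \<open>A \<times> B\<close>. The second
component keeps the first coordinate of the right argument and applies \<open>\<theta>\<close> to the second
coordinate of the left argument.\<close>

definition prod_solution ::
    "'a set \<Rightarrow> 'b set \<Rightarrow> ('b \<Rightarrow> 'b) \<Rightarrow> ('a \<times> 'b) \<times> ('a \<times> 'b) \<Rightarrow> ('a \<times> 'b) \<times> ('a \<times> 'b)" where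
  "prod_solution A B \<theta> =
     (\<lambda>((a, b), (a', b')) \<in> (A \<times> B) \<times> (A \<times> B). ((a, b'), (a', \<theta> b)))"

lemma fs_solution_prod_solution:
  assumes "\<theta> \<in> B \<rightarrow> B"
  shows "fs_solution (A \<times> B) (prod_solution A B \<theta>)"
  using assms unfolding fs_solution_iff by (auto simp: prod_solution_def)

lemma fst_prod_solution_surj:
  "(fst \<circ> prod_solution A B \<theta>) ` ((A \<times> B) \<times> (A \<times> B)) = A \<times> B"
proof
  show "A \<times> B \<subseteq> (fst \<circ> prod_solution A B \<theta>) ` ((A \<times> B) \<times> (A \<times> B))"
  proof
    fix p assume "p \<in> A \<times> B"
    then show "p \<in> (fst \<circ> prod_solution A B \<theta>) ` ((A \<times> B) \<times> (A \<times> B))"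
      by (intro image_eqI[of _ _ "(p, p)"]) (auto simp: prod_solution_def)
  qed
qed (auto simp: prod_solution_def)

lemma bij_prod_solution_iff:
  assumes \<theta>: "\<theta> \<in> B \<rightarrow> B" and a: "a \<in> A"
  shows "bij_betw (prod_solution A B \<theta>) ((A \<times> B) \<times> (A \<times> B)) ((A \<times> B) \<times> (A \<times> B)) \<longleftrightarrow>
    bij_betw \<theta> B B" (is "bij_betw ?R ?X ?X \<longleftrightarrow> _")
proof
  assume R: "bij_betw ?R ?X ?X"
  have "inj_on \<theta> B"
  proof (rule inj_onI)
    fix b b' assume b: "b \<in> B" "b' \<in> B" "\<theta> b = \<theta> b'"
    then have "?R ((a, b), (a, b)) = ?R ((a, b'), (a, b))"
      using a by (simp add: prod_solution_def)
    then show "b = b'"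
      using bij_betw_imp_inj_on[OF R] a b by (auto dest: inj_onD)
  qed
  moreover have "B \<subseteq> \<theta> ` B"
  proof
    fix b assume "b \<in> B"
    then have "((a, b), (a, b)) \<in> ?R ` ?X"
      using a bij_betw_imp_surj_on[OF R] by simp
    then show "b \<in> \<theta> ` B"
      by (auto simp: prod_solution_def)
  qed
  ultimately show "bij_betw \<theta> B B"
    using \<theta> by (auto simp: bij_betw_def)
next
  assume "bij_betw \<theta> B B"
  then have inj: "inj_on \<theta> B" and im: "\<theta> ` B = B"
    by (auto simp: bij_betw_def)
  have "inj_on ?R ?X"
    using inj by (auto intro!: inj_onI simp: prod_solution_def dest: inj_onD)
  moreover have "?X \<subseteq> ?R ` ?X"
  proof
    fix q assume "q \<in> ?X"
    then obtain a b a' c where q: "q = ((a, b), (a', c))" "a \<in> A" "b \<in> B" "a' \<in> A" "c \<in> B"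
      by auto
    obtain b' where "b' \<in> B" "c = \<theta> b'"
      using im q(5) by blast
    then show "q \<in> ?R ` ?X"
      using q by (intro image_eqI[of _ _ "((a, b'), (a', b))"]) (auto simp: prod_solution_def)
  qed
  moreover have "?R ` ?X \<subseteq> ?X"
    using \<theta> by (auto simp: prod_solution_def)
  ultimately show "bij_betw ?R ?X ?X"
    by (auto simp: bij_betw_def)
qed

lemma fs_isomorphic_iff:
  "fs_isomorphic X R Y Q \<longleftrightarrow> (\<exists>\<sigma>. bij_betw \<sigma> X Y \<and>
    (\<forall>x\<in>X. \<forall>y\<in>X. \<sigma> (fst (R (x, y))) = fst (Q (\<sigma> x, \<sigma> y)) \<and>
                  \<sigma> (snd (R (x, y))) = snd (Q (\<sigma> x, \<sigma> y))))"
  unfolding fs_isomorphic_def by (simp add: prod_eq_iff)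

lemma fs_isomorphic_imp_conjugate:
  assumes "fs_isomorphic X R Y Q"
  shows "conjugate (X \<times> X) R (Y \<times> Y) Q"
  using assms unfolding fs_isomorphic_def conjugate_def
  by (metis bij_betw_map_prod comp_apply)

text \<open>Standard models live on sets of pairs of numbers; they have to be carried over to \<open>X\<close> to
show that every invariant occurs among the solutions on \<open>X\<close>.\<close>

lemma transport_solution:
  assumes Q: "fs_solution Y Q" and e: "bij_betw e X Y"
  obtains R where "fs_solution X R" "fs_isomorphic X R Y Q"
proof -
  define d where "d = inv_into X e"
  have d: "d y \<in> X" "e (d y) = y" if "y \<in> Y" for y
    using that e by (auto simp: d_def bij_betw_inv_into_right bij_betw_def inv_into_into)
  have de: "d (e x) = x" "e x \<in> Y" if "x \<in> X" for x
    using that e by (auto simp: d_def bij_betw_inv_into_left bij_betw_def)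
  have Qc: "fst (Q (x, y)) \<in> Y" "snd (Q (x, y)) \<in> Y" if "x \<in> Y" "y \<in> Y" for x y
    using Q that unfolding fs_solution_def by (metis PiE_mem mem_Sigma_iff mem_Times_iff)+
  define R where "R = restrict (map_prod d d \<circ> Q \<circ> map_prod e e) (X \<times> X)"
  have R: "fst (R (x, y)) = d (fst (Q (e x, e y)))" "snd (R (x, y)) = d (snd (Q (e x, e y)))"
    if "x \<in> X" "y \<in> X" for x y
    using that by (simp_all add: R_def)
  have Rc: "R \<in> X \<times> X \<rightarrow>\<^sub>E X \<times> X"
    using d(1) de(2) Qc by (auto simp: R_def mem_Times_iff)
  have "fs_solution X R"
    unfolding fs_solution_iff
    using Q[unfolded fs_solution_iff] by (intro conjI Rc) (auto simp: R d de Qc)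
  moreover have "fs_isomorphic X R Y Q"
    unfolding fs_isomorphic_def
    using e by (intro exI[of _ e]) (auto simp: R prod_eq_iff d de Qc)
  ultimately show ?thesis
    by (rule that)
qed

lemma fst_surj_of_isomorphic:
  assumes R: "R \<in> X \<times> X \<rightarrow>\<^sub>E X \<times> X" and iso: "fs_isomorphic X R Y Q"
    and Q: "(fst \<circ> Q) ` (Y \<times> Y) = Y"
  shows "(fst \<circ> R) ` (X \<times> X) = X"
proof
  show "(fst \<circ> R) ` (X \<times> X) \<subseteq> X"
    using R by (fastforce dest: PiE_mem simp: mem_Times_iff)
  obtain \<sigma> where \<sigma>: "bij_betw \<sigma> X Y"
    "\<forall>x\<in>X. \<forall>y\<in>X. \<sigma> (fst (R (x, y))) = fst (Q (\<sigma> x, \<sigma> y))"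
    using iso unfolding fs_isomorphic_iff by blast
  show "X \<subseteq> (fst \<circ> R) ` (X \<times> X)"
  proof
    fix x assume x: "x \<in> X"
    then have "\<sigma> x \<in> (fst \<circ> Q) ` (Y \<times> Y)"
      using Q \<sigma>(1) by (auto simp: bij_betw_def)
    then obtain u v where "u \<in> Y" "v \<in> Y" "\<sigma> x = fst (Q (u, v))"
      by auto
    then obtain a b where ab: "a \<in> X" "b \<in> X" "\<sigma> x = fst (Q (\<sigma> a, \<sigma> b))"
      using \<sigma>(1) by (auto simp: bij_betw_def)
    then have "\<sigma> (fst (R (a, b))) = \<sigma> x"
      using \<sigma>(2) by simp
    moreover have "fst (R (a, b)) \<in> X"
      using R ab by (metis PiE_mem mem_Sigma_iff mem_Times_iff)
    ultimately have "fst (R (a, b)) = x"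
      using x bij_betw_imp_inj_on[OF \<sigma>(1)] by (auto dest: inj_onD)
    then show "x \<in> (fst \<circ> R) ` (X \<times> X)"
      using ab by (intro image_eqI[of _ _ "(a, b)"]) auto
  qed
qed

text \<open>Surjectivity makes the product \<open>x y\<close> idempotent: if \<open>x = a b\<close> then
\<open>x x = (a b) (a b) = a b = x\<close>. So \<open>X\<close> is a rectangular band. For a fixed \<open>w\<close>, the map
\<open>x \<mapsto> (x w, w x)\<close> is a bijection from \<open>X\<close> to \<open>X w \<times> w X\<close> with inverse \<open>(a, b) \<mapsto> a b\<close>. The
remaining identities give \<open>(x * y) w = (y (x * y)) w = y w\<close> and
\<open>w (x * y) = x * w = (w x) * w\<close>, so that \<open>x * y\<close> depends on \<open>y w\<close> and \<open>w x\<close> only.\<close>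

theorem solution_decomposition:
  fixes X :: "'a set"
  assumes R: "fs_solution X R" and surj: "(fst \<circ> R) ` (X \<times> X) = X"
  obtains A B :: "'a set" and \<theta>
  where "\<theta> \<in> B \<rightarrow> B" "fs_isomorphic X R (A \<times> B) (prod_solution A B \<theta>)"
proof (cases "X = {}")
  case True
  then have "fs_isomorphic X R ({} \<times> {}) (prod_solution {} {} id)"
    by (simp add: fs_isomorphic_def bij_betw_def)
  then show ?thesis
    by (rule that[rotated]) simp
next
  case False
  then obtain w where w: "w \<in> X"
    by blast
  define f where "f x y = fst (R (x, y))" for x y
  define g where "g x y = snd (R (x, y))" for x y
  have fX: "f x y \<in> X" and gX: "g x y \<in> X" if "x \<in> X" "y \<in> X" for x y
    using R that unfolding fs_solution_def f_def g_def
    by (metis PiE_mem mem_Sigma_iff mem_Times_iff)+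
  have ff1: "f x (f y z) = f x z" and ff2: "f (f x y) z = f x z"
    and fg: "f y (g x z) = g x y" and gf: "g (f x y) z = g y z"
    if "x \<in> X" "y \<in> X" "z \<in> X" for x y z
    using R that unfolding fs_solution_iff f_def g_def by blast+
  have idem: "f x x = x" if "x \<in> X" for x
  proof -
    have "x \<in> (fst \<circ> R) ` (X \<times> X)"
      unfolding surj by (rule that)
    then obtain a b where ab: "a \<in> X" "b \<in> X" "x = f a b"
      by (auto simp: f_def)
    then show ?thesis
      by (simp add: ff1 ff2 fX)
  qed
  define A where "A = (\<lambda>x. f x w) ` X"
  define B where "B = (\<lambda>x. f w x) ` X"
  define \<theta> where "\<theta> b = g b w" for b
  define \<sigma> where "\<sigma> x = (f x w, f w x)" for x
  have AB: "A \<subseteq> X" "B \<subseteq> X"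
    using fX w by (auto simp: A_def B_def)
  have \<theta>: "\<theta> \<in> B \<rightarrow> B"
  proof
    fix b assume "b \<in> B"
    then have b: "b \<in> X"
      using AB by blast
    then have "g b w = f w (g b w)"
      using fg w by simp
    then show "\<theta> b \<in> B"
      using gX[OF b w] by (auto simp: \<theta>_def B_def)
  qed
  have "bij_betw \<sigma> X (A \<times> B)"
    unfolding bij_betw_def
  proof
    show "inj_on \<sigma> X"
    proof (rule inj_on_inverseI)
      fix x assume "x \<in> X"
      then show "(\<lambda>(a, b). f a b) (\<sigma> x) = x"
        using w by (simp add: \<sigma>_def ff1 ff2 fX idem)
    qed
    show "\<sigma> ` X = A \<times> B"
    proof
      show "A \<times> B \<subseteq> \<sigma> ` X"
      proof
        fix p assume "p \<in> A \<times> B"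
        then obtain x y where xy: "x \<in> X" "y \<in> X" "p = (f x w, f w y)"
          by (auto simp: A_def B_def)
        then have "p = \<sigma> (f x y)"
          using w by (simp add: \<sigma>_def ff1 ff2)
        then show "p \<in> \<sigma> ` X"
          using xy fX by blast
      qed
    qed (auto simp: \<sigma>_def A_def B_def)
  qed
  moreover have "\<sigma> (f x y) = (f x w, f w y) \<and> \<sigma> (g x y) = (f y w, \<theta> (f w x))"
    if x: "x \<in> X" and y: "y \<in> X" for x y
  proof -
    have "f (g x y) w = f (f y (g x y)) w"
      using fg x y by simp
    also have "\<dots> = f y w"
      using ff2 gX x y w by simp
    finally have "f (g x y) w = f y w" .
    moreover have "f w (g x y) = \<theta> (f w x)"
      using fg gf x y w by (simp add: \<theta>_def)
    ultimately show ?thesis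
      using x y w by (simp add: \<sigma>_def ff1 ff2)
  qed
  ultimately have "fs_isomorphic X R (A \<times> B) (prod_solution A B \<theta>)"
    unfolding fs_isomorphic_def
    by (intro exI[of _ \<sigma>]) (auto simp: prod_solution_def prod_eq_iff f_def g_def \<sigma>_def A_def B_def)
  with \<theta> show ?thesis
    by (rule that)
qed

lemma prod_solution_isomorphic:
  assumes \<alpha>: "bij_betw \<alpha> A A'" and conj: "conjugate B \<theta> B' \<theta>'"
  shows "fs_isomorphic (A \<times> B) (prod_solution A B \<theta>) (A' \<times> B') (prod_solution A' B' \<theta>')"
proof -
  obtain \<beta> where \<beta>: "bij_betw \<beta> B B'" "\<And>b. b \<in> B \<Longrightarrow> \<beta> (\<theta> b) = \<theta>' (\<beta> b)"
    using conj unfolding conjugate_def by auto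
  have "bij_betw (map_prod \<alpha> \<beta>) (A \<times> B) (A' \<times> B')"
    using \<alpha> \<beta>(1) by (rule bij_betw_map_prod)
  then show ?thesis
    unfolding fs_isomorphic_def
    using bij_betwE[OF \<alpha>] bij_betwE[OF \<beta>(1)] \<beta>(2)
    by (intro exI[of _ "map_prod \<alpha> \<beta>"]) (auto simp: prod_solution_def)
qed

text \<open>A rectangular band determines its two coordinates: an isomorphism preserves the first
component \<open>(a, b) (a', b') = (a, b')\<close>, so it sends points with equal second coordinate to points with equal
second coordinate and likewise for the first. It is therefore a product of two bijections, and
the one on second coordinates conjugates \<open>\<theta>\<close> to \<open>\<theta>'\<close>. Nonempty factors are essential: with
\<open>B\<close> and \<open>A'\<close> empty, both carriers are empty whatever \<open>B'\<close> is.\<close>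

lemma conjugate_of_prod_solution_isomorphic:
  assumes iso: "fs_isomorphic (A \<times> B) (prod_solution A B \<theta>) (A' \<times> B') (prod_solution A' B' \<theta>')"
    and w: "w \<in> A" and b0: "b0 \<in> B" and \<theta>: "\<theta> \<in> B \<rightarrow> B"
  shows "conjugate B \<theta> B' \<theta>'"
proof -
  obtain \<sigma> where \<sigma>: "bij_betw \<sigma> (A \<times> B) (A' \<times> B')"
    and eq: "\<forall>p\<in>A \<times> B. \<forall>q\<in>A \<times> B.
      \<sigma> (fst (prod_solution A B \<theta> (p, q))) = fst (prod_solution A' B' \<theta>' (\<sigma> p, \<sigma> q)) \<and>
      \<sigma> (snd (prod_solution A B \<theta> (p, q))) = snd (prod_solution A' B' \<theta>' (\<sigma> p, \<sigma> q))"
    using iso unfolding fs_isomorphic_iff by blast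
  have mem: "\<sigma> p \<in> A' \<times> B'" if "p \<in> A \<times> B" for p
    using that bij_betwE[OF \<sigma>] by blast
  have mul: "\<sigma> (a, b') = (fst (\<sigma> (a, b)), snd (\<sigma> (a', b')))"
    if "a \<in> A" "b \<in> B" "a' \<in> A" "b' \<in> B" for a b a' b'
    using eq[rule_format, of "(a, b)" "(a', b')"] mem[of "(a, b)"] mem[of "(a', b')"] that
    by (auto simp: prod_solution_def mem_Times_iff case_prod_unfold)
  define \<rho> where "\<rho> b = snd (\<sigma> (w, b))" for b
  have "inj_on \<rho> B"
  proof (rule inj_onI)
    fix b b' assume b: "b \<in> B" "b' \<in> B" "\<rho> b = \<rho> b'"
    then have "\<sigma> (w, b) = \<sigma> (w, b')"
      using mul[of w b w b'] w by (metis \<rho>_def prod.collapse)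
    then show "b = b'"
      using bij_betw_imp_inj_on[OF \<sigma>] b w by (auto dest: inj_onD)
  qed
  moreover have "\<rho> ` B = B'"
  proof
    show "\<rho> ` B \<subseteq> B'"
      using mem w by (auto simp: \<rho>_def mem_Times_iff)
    show "B' \<subseteq> \<rho> ` B"
    proof
      fix b' assume b': "b' \<in> B'"
      have "(fst (\<sigma> (w, b0)), b') \<in> \<sigma> ` (A \<times> B)"
        using mem[of "(w, b0)"] w b0 b' bij_betw_imp_surj_on[OF \<sigma>] by (simp add: mem_Times_iff)
      then obtain a b where ab: "a \<in> A" "b \<in> B" "snd (\<sigma> (a, b)) = b'"
        by auto (metis snd_conv)
      then have "\<rho> b = b'"
        using arg_cong[OF mul[of w b a b], of snd] w by (simp add: \<rho>_def)
      then show "b' \<in> \<rho> ` B"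
        using ab by blast
    qed
  qed
  moreover have "\<rho> (\<theta> b) = \<theta>' (\<rho> b)" if b: "b \<in> B" for b
    using eq[rule_format, of "(w, b)" "(w, b)"] mem[of "(w, b)"] w b
    by (auto simp: prod_solution_def \<rho>_def mem_Times_iff case_prod_unfold)
  ultimately show ?thesis
    unfolding conjugate_def bij_betw_def by blast
qed

section \<open>Isomorphism classes of solutions\<close>

abbreviation grid :: "nat \<Rightarrow> nat \<Rightarrow> (nat \<times> nat) set" where
  "grid n m \<equiv> {1..n div m} \<times> {1..m}"

abbreviation grid_solution ::
    "nat \<Rightarrow> nat \<Rightarrow> (nat \<Rightarrow> nat) \<Rightarrow> (nat \<times> nat) \<times> (nat \<times> nat) \<Rightarrow> (nat \<times> nat) \<times> (nat \<times> nat)" where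
  "grid_solution n m \<equiv> prod_solution {1..n div m} {1..m}"

lemma grid_solution_of_solution:
  fixes X :: "'a set"
  assumes X: "finite X" "card X = n" "n > 0"
    and R: "fs_solution X R" "(fst \<circ> R) ` (X \<times> X) = X"
  obtains m f where "m dvd n" "f \<in> {1..m} \<rightarrow>\<^sub>E {1..m}" "fs_isomorphic X R (grid n m) (grid_solution n m f)"
proof -
  obtain A B :: "'a set" and \<theta> where \<theta>: "\<theta> \<in> B \<rightarrow> B"
    and iso: "fs_isomorphic X R (A \<times> B) (prod_solution A B \<theta>)"
    using solution_decomposition[OF R] .
  then obtain \<sigma> where "bij_betw \<sigma> X (A \<times> B)"
    unfolding fs_isomorphic_iff by blast
  then have "finite (A \<times> B)" and card: "card A * card B = n"
    using X bij_betw_finite bij_betw_same_card card_cartesian_product by metis+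
  moreover have "A \<noteq> {}" "B \<noteq> {}"
    using card X(3) by auto
  ultimately have fin: "finite A" "finite B"
    by (auto simp: finite_cartesian_product_iff)
  have "card B > 0"
    using fin(2) \<open>B \<noteq> {}\<close> by (simp add: card_gt_0_iff)
  then have cardA: "card A = n div card B"
    using card by auto
  obtain \<alpha> where "bij_betw \<alpha> A {1..n div card B}"
    using fin(1) cardA by (metis card_atLeastAtMost diff_Suc_1 finite_atLeastAtMost finite_same_card_bij)
  moreover obtain f where f: "f \<in> {1..card B} \<rightarrow>\<^sub>E {1..card B}" "conjugate B \<theta> {1..card B} f"
    using conjugate_to_carrier[OF \<theta> fin(2), of "{1..card B}"] by auto
  ultimately have "fs_isomorphic X R (grid n (card B)) (grid_solution n (card B) f)"
    using fs_isomorphic_trans[OF iso] prod_solution_isomorphic by blast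
  moreover have "card B dvd n"
    using card by auto
  ultimately show ?thesis
    using that f(1) by blast
qed

text \<open>The invariant of a solution is the pair of the number \<open>m = card B\<close> and the conjugacy class
of \<open>\<theta>\<close>; the other factor is then forced to have \<open>n div m\<close> elements. The family \<open>F\<close> of
self-maps selects the solutions to be counted, so that one argument serves both the surjective
and the bijective case.\<close>

lemma card_iso_classes:
  fixes X :: "'a set" and F :: "nat \<Rightarrow> (nat \<Rightarrow> nat) set"
  assumes X: "finite X" "card X = n" "n > 0"
    and S: "S \<subseteq> {R. fs_solution X R \<and> (fst \<circ> R) ` (X \<times> X) = X}"
    and F: "\<And>m. F m \<subseteq> {1..m} \<rightarrow>\<^sub>E {1..m}"
    and SF: "\<And>R m f. fs_solution X R \<Longrightarrow> m dvd n \<Longrightarrow> f \<in> {1..m} \<rightarrow>\<^sub>E {1..m} \<Longrightarrow>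
      fs_isomorphic X R (grid n m) (grid_solution n m f) \<Longrightarrow> R \<in> S \<longleftrightarrow> f \<in> F m"
  shows "card (iso_classes X S) = (\<Sum>m | m dvd n. card (F m // conj_rel m (F m)))"
proof -
  let ?I = "SIGMA m:{m. m dvd n}. F m // conj_rel m (F m)"
  let ?Q = "\<lambda>R (m, C). \<exists>f\<in>C. fs_isomorphic X R (grid n m) (grid_solution n m f)"
  let ?r = "{(R, R'). R \<in> S \<and> R' \<in> S \<and> fs_isomorphic X R X R'}"
  note eqv = equiv_conj_rel[OF F]
  have FPi: "f \<in> {1..m} \<rightarrow> {1..m}" if "f \<in> F m" for f m
    using that F by (blast intro: PiE_mem)
  have Spi: "R \<in> X \<times> X \<rightarrow>\<^sub>E X \<times> X" if "R \<in> S" for R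
    using that S unfolding fs_solution_def by blast
  have div_pos: "1 \<in> {1..n div m}" if "m dvd n" for m
    using that X(3) by (auto simp: dvd_def)
  have m_pos: "1 \<in> {1..m}" if "m dvd n" for m
    using that X(3) by (auto simp: Suc_le_eq intro: dvd_pos_nat)
  have "card (iso_classes X S) = card ?I"
    unfolding iso_classes_def
  proof (rule card_quotient_by_invariant[where Q = ?Q])
    show "equiv S ?r"
      using S by (intro equiv_fs_isomorphic) auto
    show "\<exists>i\<in>?I. ?Q R i" if "R \<in> S" for R
    proof -
      have R: "fs_solution X R" "(fst \<circ> R) ` (X \<times> X) = X"
        using that S by auto
      obtain m f where mf: "m dvd n" "f \<in> {1..m} \<rightarrow>\<^sub>E {1..m}"
          "fs_isomorphic X R (grid n m) (grid_solution n m f)"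
        using grid_solution_of_solution[OF X R] .
      then have f: "f \<in> F m"
        using SF R(1) that by blast
      then have "(m, conj_rel m (F m) `` {f}) \<in> ?I" "f \<in> conj_rel m (F m) `` {f}"
        using mf(1) equiv_class_self[OF eqv f] by (auto intro: quotientI)
      then show ?thesis
        using mf(3) by blast
    qed
    show "\<exists>R\<in>S. ?Q R i" if iI: "i \<in> ?I" for i
    proof -
      obtain m C where i: "i = (m, C)" "m dvd n" "C \<in> F m // conj_rel m (F m)"
        using iI by auto
      obtain f where f: "f \<in> C" "f \<in> F m"
        using i(3) in_quotient_imp_non_empty[OF eqv i(3)] in_quotient_imp_subset[OF eqv i(3)] by blast
      have "card X = card (grid n m)"
        using X(2) i(2) by simp
      then obtain e where "bij_betw e X (grid n m)"
        using X(1) by (metis finite_SigmaI finite_atLeastAtMost finite_same_card_bij)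
      then obtain R where "fs_solution X R" "fs_isomorphic X R (grid n m) (grid_solution n m f)"
        using transport_solution fs_solution_prod_solution[OF FPi[OF f(2)]] by metis
      then show ?thesis
        using SF[of R m f] i(1,2) f F by blast
    qed
    fix R R' i i'
    assume RS: "R \<in> S" "R' \<in> S" and I: "i \<in> ?I" "i' \<in> ?I" and Q: "?Q R i" "?Q R' i'"
    obtain m C where i: "i = (m, C)" "m dvd n" "C \<in> F m // conj_rel m (F m)"
      using I(1) by auto
    obtain m' C' where i': "i' = (m', C')" "m' dvd n" "C' \<in> F m' // conj_rel m' (F m')"
      using I(2) by auto
    obtain f where f: "f \<in> C" "fs_isomorphic X R (grid n m) (grid_solution n m f)"
      using Q(1) i(1) by auto
    obtain f' where f': "f' \<in> C'" "fs_isomorphic X R' (grid n m') (grid_solution n m' f')"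
      using Q(2) i'(1) by auto
    have fF: "f \<in> F m" "f' \<in> F m'"
      using f(1) f'(1) in_quotient_imp_subset[OF eqv i(3)] in_quotient_imp_subset[OF eqv i'(3)] by auto
    show "(R, R') \<in> ?r \<longleftrightarrow> i = i'"
    proof
      assume "(R, R') \<in> ?r"
      then have "fs_isomorphic X R X R'"
        by simp
      then have "fs_isomorphic (grid n m) (grid_solution n m f) (grid n m') (grid_solution n m' f')"
        using f'(2) fs_isomorphic_trans[OF fs_isomorphic_sym[OF Spi[OF RS(1)] f(2)]]
        by (metis fs_isomorphic_trans)
      then have conj: "conjugate {1..m} f {1..m'} f'"
        using div_pos[OF i(2)] m_pos[OF i(2)] FPi[OF fF(1)] by (rule conjugate_of_prod_solution_isomorphic)
      then have "m = m'"
        unfolding conjugate_def by (metis bij_betw_same_card card_atLeastAtMost diff_Suc_1)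
      moreover from this conj fF have "(f, f') \<in> conj_rel m (F m)"
        by (simp add: conj_rel_def)
      ultimately show "i = i'"
        using quotient_eqI[OF eqv i(3) _ f(1)] i i' f'(1) by blast
    next
      assume "i = i'"
      then have m: "m = m'" and "C = C'"
        using i i' by auto
      then have "(f, f') \<in> conj_rel m (F m)"
        using quotient_eq_iff[OF eqv i(3) i(3) f(1)] f'(1) by blast
      then have "conjugate {1..m} f {1..m} f'"
        by (simp add: conj_rel_def)
      then have "fs_isomorphic (grid n m) (grid_solution n m f) (grid n m) (grid_solution n m f')"
        by (rule prod_solution_isomorphic[OF bij_betw_id])
      moreover have "fs_isomorphic (grid n m) (grid_solution n m f') X R'"
        using fs_isomorphic_sym[OF Spi[OF RS(2)]] f'(2) m by blast
      ultimately show "(R, R') \<in> ?r"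
        using RS fs_isomorphic_trans[OF f(2)] fs_isomorphic_trans by blast
    qed
  qed
  also have "\<dots> = (\<Sum>m | m dvd n. card (F m // conj_rel m (F m)))"
  proof (rule card_SigmaI)
    show "finite {m. m dvd n}"
      using X(3) by simp
    show "\<forall>m\<in>{m. m dvd n}. finite (F m // conj_rel m (F m))"
    proof
      fix m
      have "finite (F m)"
        using F by (rule finite_subset) (simp add: finite_PiE)
      then show "finite (F m // conj_rel m (F m))"
        using equiv_type[OF eqv] by (simp add: finite_quotient)
    qed
  qed
  finally show ?thesis .
qed

theorem corollary2p22:
  fixes n :: nat and X :: "'a set"
  assumes "n > 0" and "finite X" and "card X = n"
  shows "fs1 X = (\<Sum>m | m dvd n. davis m)
       \<and> fsb X = (\<Sum>m | m dvd n. partition_number m)"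
proof
  note X = assms(2,3,1)
  have surj: "(fst \<circ> R) ` (X \<times> X) = X"
    if "fs_solution X R" "fs_isomorphic X R (grid n m) (grid_solution n m f)" for R m f
    using that fst_surj_of_isomorphic[OF _ that(2) fst_prod_solution_surj]
    by (simp add: fs_solution_def)
  show "fs1 X = (\<Sum>m | m dvd n. davis m)"
    unfolding fs1_def card_conjugacy_classes_self_maps[symmetric]
  proof (rule card_iso_classes[OF X])
    fix R :: "'a \<times> 'a \<Rightarrow> 'a \<times> 'a" and m f
    assume "fs_solution X R" "f \<in> {1..m} \<rightarrow>\<^sub>E {1..m}"
      "fs_isomorphic X R (grid n m) (grid_solution n m f)"
    then show "R \<in> {R. fs_solution X R \<and> (fst \<circ> R) ` (X \<times> X) = X} \<longleftrightarrow>
        f \<in> {1..m} \<rightarrow>\<^sub>E {1..m}"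
      using surj by blast
  qed auto
  show "fsb X = (\<Sum>m | m dvd n. partition_number m)"
    unfolding fsb_def card_conjugacy_classes_permutations[symmetric]
  proof (rule card_iso_classes[OF X])
    \<comment> \<open>A bijective solution is covered by the decomposition, as its first component is onto.\<close>
    have "(fst \<circ> R) ` (X \<times> X) = X" if "bij_betw R (X \<times> X) (X \<times> X)" for R :: "'a \<times> 'a \<Rightarrow> 'a \<times> 'a"
      unfolding image_comp[symmetric] bij_betw_imp_surj_on[OF that] by simp
    then show "{R. fs_solution X R \<and> bij_betw R (X \<times> X) (X \<times> X)}
        \<subseteq> {R. fs_solution X R \<and> (fst \<circ> R) ` (X \<times> X) = X}"
      by blast
    fix R :: "'a \<times> 'a \<Rightarrow> 'a \<times> 'a" and m f
    assume R: "fs_solution X R" and m: "m dvd n" and f: "f \<in> {1..m} \<rightarrow>\<^sub>E {1..m}"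
      and iso: "fs_isomorphic X R (grid n m) (grid_solution n m f)"
    note conj = fs_isomorphic_imp_conjugate[OF iso]
    have "R \<in> X \<times> X \<rightarrow> X \<times> X"
      using R by (auto simp: fs_solution_def)
    then have "bij_betw R (X \<times> X) (X \<times> X) \<longleftrightarrow>
        bij_betw (grid_solution n m f) (grid n m \<times> grid n m) (grid n m \<times> grid n m)"
      using conjugate_bij_betw[OF conj] conjugate_bij_betw[OF conjugate_sym[OF conj]] by blast
    also have "\<dots> \<longleftrightarrow> bij_betw f {1..m} {1..m}"
    proof (rule bij_prod_solution_iff)
      show "f \<in> {1..m} \<rightarrow> {1..m}"
        using f by blast
      show "1 \<in> {1..n div m}"
        using m \<open>n > 0\<close> by (auto simp: dvd_def)
    qed
    finally show "R \<in> {R. fs_solution X R \<and> bij_betw R (X \<times> X) (X \<times> X)} \<longleftrightarrow>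
        f \<in> {f \<in> {1..m} \<rightarrow>\<^sub>E {1..m}. bij_betw f {1..m} {1..m}}"
      using R f by simp
  qed auto
qed

end
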